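(* The functor $\Phi\colon \mathbf{Grp}^{\mathrm{op}}\to \mathbf{Comonads}(\mathbf{Set})$, $G\mapsto K_G$, induces an equivalence of categories $\mathbf{Grp}^{\mathrm{op}}\simeq \mathbf{GrpComonads}$. In other words, the assignment $G\mapsto K_G$ is a fully faithful contravariant embedding of the category of groups into the category of comonads on $\mathbf{Set}$.
   Context: For a group $G$, the comonad $K_G=(K_G,\epsilon^G,\delta^G)$ on $\mathbf{Set}$ is given by: $K_G(X)=X^G$, the set of all functions $G\to X$; $K_G(f)(\phi)=f\circ\phi$ for a map $f\colon X\to Y$; counit $\epsilon^G_X\colon X^G\to X$, $\epsilon^G_X(\phi)=\phi(e_G)$; comultiplication $\delta^G_X\colon X^G\to (X^G)^G$, $\delta^G_X(\phi)(g)(h)=\phi(gh)$. A morphism of comonads $(K,\epsilon,\delta)\to(K',\epsilon',\delta')$ on a category is a natural transformation $\phi\colon K\Rightarrow K'$ with $\epsilon'\circ\phi=\epsilon$ and $\delta'\circ\phi=(\phi\phi)\circ\delta$, where $\phi\phi\colon K^2\Rightarrow K'^2$ is the horizontal composite. $\mathbf{Comonads}(\mathbf{Set})$ is the category of comonads on $\mathbf{Set}$ and morphisms of comonads. The functor $\Phi$ sends $G$ to $K_G$ and a group morphism $f\colon G\to H$ to the comonad morphism $\Phi(f)\colon K_H\Rightarrow K_G$ with components $\Phi(f)_X(\psi)=\psi\circ f$ for $\psi\in X^H$. $\mathbf{GrpComonads}$ is the full subcategory of $\mathbf{Comonads}(\mathbf{Set})$ whose objects are the comonads isomorphic to $K_G$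 for some group $G$. *)

theory Defs
  imports "HOL-Algebra.Group" "HOL-Library.Nat_Bijection" "HOL-Library.FuncSet"
begin

section \<open>Categories, functors, natural transformations\<close>

text \<open>Hom-sets of different pairs of objects need not be disjoint; composition therefore takes
  the three objects as arguments: \<open>Comp C a b c g f\<close> is \<open>g \<circ> f\<close> for \<open>f : a \<rightarrow> b\<close>, \<open>g : b \<rightarrow> c\<close>.\<close>

record ('o, 'm) cat =
  Ob :: "'o set"
  Hom :: "'o \<Rightarrow> 'o \<Rightarrow> 'm set"
  Ident :: "'o \<Rightarrow> 'm"
  Comp :: "'o \<Rightarrow> 'o \<Rightarrow> 'o \<Rightarrow> 'm \<Rightarrow> 'm \<Rightarrow> 'm"

definition category :: "('o, 'm) cat \<Rightarrow> bool" where
  "category C \<longleftrightarrow>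
     (\<forall>a\<in>Ob C. Ident C a \<in> Hom C a a) \<and>
     (\<forall>a\<in>Ob C. \<forall>b\<in>Ob C. \<forall>c\<in>Ob C. \<forall>f\<in>Hom C a b. \<forall>g\<in>Hom C b c.
        Comp C a b c g f \<in> Hom C a c) \<and>
     (\<forall>a\<in>Ob C. \<forall>b\<in>Ob C. \<forall>f\<in>Hom C a b.
        Comp C a a b f (Ident C a) = f \<and> Comp C a b b (Ident C b) f = f) \<and>
     (\<forall>a\<in>Ob C. \<forall>b\<in>Ob C. \<forall>c\<in>Ob C. \<forall>d\<in>Ob C.
        \<forall>f\<in>Hom C a b. \<forall>g\<in>Hom C b c. \<forall>h\<in>Hom C c d.
          Comp C a c d h (Comp C a b c g f) = Comp C a b d (Comp C b c d h g) f)"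

definition op_cat :: "('o, 'm) cat \<Rightarrow> ('o, 'm) cat" where
  "op_cat C = \<lparr>Ob = Ob C, Hom = (\<lambda>a b. Hom C b a), Ident = Ident C,
     Comp = (\<lambda>a b c g f. Comp C c b a f g)\<rparr>"

definition full_subcat :: "('o, 'm) cat \<Rightarrow> 'o set \<Rightarrow> ('o, 'm) cat" where
  "full_subcat C P = C\<lparr>Ob := Ob C \<inter> P\<rparr>"

definition cat_iso :: "('o, 'm) cat \<Rightarrow> 'o \<Rightarrow> 'o \<Rightarrow> 'm \<Rightarrow> bool" where
  "cat_iso C a b f \<longleftrightarrow> f \<in> Hom C a b \<and>
     (\<exists>g\<in>Hom C b a. Comp C a b a g f = Ident C a \<and> Comp C b a b f g = Ident C b)"

definition isomorphic :: "('o, 'm) cat \<Rightarrow> 'o \<Rightarrow> 'o \<Rightarrow> bool" where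
  "isomorphic C a b \<longleftrightarrow> (\<exists>f. cat_iso C a b f)"

record ('o, 'm, 'p, 'n) ftor =
  Fob :: "'o \<Rightarrow> 'p"
  Fmap :: "'o \<Rightarrow> 'o \<Rightarrow> 'm \<Rightarrow> 'n"

definition is_functor ::
  "('o, 'm) cat \<Rightarrow> ('p, 'n) cat \<Rightarrow> ('o, 'm, 'p, 'n) ftor \<Rightarrow> bool" where
  "is_functor C D F \<longleftrightarrow> category C \<and> category D \<and>
     (\<forall>a\<in>Ob C. Fob F a \<in> Ob D) \<and>
     (\<forall>a\<in>Ob C. \<forall>b\<in>Ob C. \<forall>f\<in>Hom C a b. Fmap F a b f \<in> Hom D (Fob F a) (Fob F b)) \<and>
     (\<forall>a\<in>Ob C. Fmap F a a (Ident C a) = Ident D (Fob F a)) \<and>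
     (\<forall>a\<in>Ob C. \<forall>b\<in>Ob C. \<forall>c\<in>Ob C. \<forall>f\<in>Hom C a b. \<forall>g\<in>Hom C b c.
        Fmap F a c (Comp C a b c g f) =
        Comp D (Fob F a) (Fob F b) (Fob F c) (Fmap F b c g) (Fmap F a b f))"

definition id_ftor :: "('o, 'm, 'o, 'm) ftor" where
  "id_ftor = \<lparr>Fob = (\<lambda>a. a), Fmap = (\<lambda>a b f. f)\<rparr>"

definition comp_ftor ::
  "('p, 'n, 'q, 'k) ftor \<Rightarrow> ('o, 'm, 'p, 'n) ftor \<Rightarrow> ('o, 'm, 'q, 'k) ftor" where
  "comp_ftor G F = \<lparr>Fob = (\<lambda>a. Fob G (Fob F a)),
     Fmap = (\<lambda>a b f. Fmap G (Fob F a) (Fob F b) (Fmap F a b f))\<rparr>"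

text \<open>Components are extensional, so that natural transformations are equal
  as soon as they agree on all objects.\<close>

definition nat_trans ::
  "('o, 'm) cat \<Rightarrow> ('p, 'n) cat \<Rightarrow> ('o, 'm, 'p, 'n) ftor \<Rightarrow> ('o, 'm, 'p, 'n) ftor
     \<Rightarrow> ('o \<Rightarrow> 'n) \<Rightarrow> bool" where
  "nat_trans C D F G \<eta> \<longleftrightarrow> is_functor C D F \<and> is_functor C D G \<and>
     \<eta> \<in> (\<Pi>\<^sub>E a\<in>Ob C. Hom D (Fob F a) (Fob G a)) \<and>
     (\<forall>a\<in>Ob C. \<forall>b\<in>Ob C. \<forall>f\<in>Hom C a b.
        Comp D (Fob F a) (Fob F b) (Fob G b) (\<eta> b) (Fmap F a b f) =
        Comp D (Fob F a) (Fob G a) (Fob G b) (Fmap G a b f) (\<eta> a))"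

definition nat_iso ::
  "('o, 'm) cat \<Rightarrow> ('p, 'n) cat \<Rightarrow> ('o, 'm, 'p, 'n) ftor \<Rightarrow> ('o, 'm, 'p, 'n) ftor
     \<Rightarrow> ('o \<Rightarrow> 'n) \<Rightarrow> bool" where
  "nat_iso C D F G \<eta> \<longleftrightarrow> nat_trans C D F G \<eta> \<and>
     (\<forall>a\<in>Ob C. cat_iso D (Fob F a) (Fob G a) (\<eta> a))"

definition vcomp ::
  "('o, 'm) cat \<Rightarrow> ('p, 'n) cat \<Rightarrow> ('o, 'm, 'p, 'n) ftor \<Rightarrow> ('o, 'm, 'p, 'n) ftor
     \<Rightarrow> ('o, 'm, 'p, 'n) ftor \<Rightarrow> ('o \<Rightarrow> 'n) \<Rightarrow> ('o \<Rightarrow> 'n) \<Rightarrow> 'o \<Rightarrow> 'n" where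
  "vcomp C D F G H \<psi> \<phi> = (\<lambda>a\<in>Ob C. Comp D (Fob F a) (Fob G a) (Fob H a) (\<psi> a) (\<phi> a))"

text \<open>For \<open>\<phi> : F \<Rightarrow> F'\<close> (functors from \<open>C\<close> to \<open>D\<close>) and \<open>\<psi> : G \<Rightarrow> G'\<close> (functors from \<open>D\<close> to \<open>E\<close>),
  the component of \<open>\<psi>\<phi> : G F \<Rightarrow> G' F'\<close> at \<open>a\<close> is \<open>\<psi>\<close> at \<open>F' a\<close> after \<open>G\<close> of \<open>\<phi>\<close> at \<open>a\<close>.\<close>

definition hcomp ::
  "('o, 'm) cat \<Rightarrow> ('q, 'k) cat \<Rightarrow> ('o, 'm, 'p, 'n) ftor \<Rightarrow> ('o, 'm, 'p, 'n) ftor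
     \<Rightarrow> ('p, 'n, 'q, 'k) ftor \<Rightarrow> ('p, 'n, 'q, 'k) ftor
     \<Rightarrow> ('p \<Rightarrow> 'k) \<Rightarrow> ('o \<Rightarrow> 'n) \<Rightarrow> 'o \<Rightarrow> 'k" where
  "hcomp C E F F' G G' \<psi> \<phi> =
     (\<lambda>a\<in>Ob C. Comp E (Fob G (Fob F a)) (Fob G (Fob F' a)) (Fob G' (Fob F' a))
                  (\<psi> (Fob F' a)) (Fmap G (Fob F a) (Fob F' a) (\<phi> a)))"

definition fully_faithful ::
  "('o, 'm) cat \<Rightarrow> ('p, 'n) cat \<Rightarrow> ('o, 'm, 'p, 'n) ftor \<Rightarrow> bool" where
  "fully_faithful C D F \<longleftrightarrow> is_functor C D F \<and>
     (\<forall>a\<in>Ob C. \<forall>b\<in>Ob C. bij_betw (Fmap F a b) (Hom C a b) (Hom D (Fob F a) (Fob F b)))"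

definition is_equivalence ::
  "('o, 'm) cat \<Rightarrow> ('p, 'n) cat \<Rightarrow> ('o, 'm, 'p, 'n) ftor \<Rightarrow> bool" where
  "is_equivalence C D F \<longleftrightarrow> is_functor C D F \<and>
     (\<exists>G. is_functor D C G \<and>
        (\<exists>\<eta>. nat_iso C C id_ftor (comp_ftor G F) \<eta>) \<and>
        (\<exists>\<epsilon>. nat_iso D D (comp_ftor F G) id_ftor \<epsilon>))"

section \<open>Comonads\<close>

record ('o, 'm) comonad =
  endo :: "('o, 'm, 'o, 'm) ftor"
  counit :: "'o \<Rightarrow> 'm"
  comult :: "'o \<Rightarrow> 'm"

definition is_comonad :: "('o, 'm) cat \<Rightarrow> ('o, 'm) comonad \<Rightarrow> bool" where
  "is_comonad C K \<longleftrightarrow>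
     (let T = endo K; T0 = Fob T; \<epsilon> = counit K; \<delta> = comult K in
       is_functor C C T \<and>
       nat_trans C C T id_ftor \<epsilon> \<and>
       nat_trans C C T (comp_ftor T T) \<delta> \<and>
       (\<forall>a\<in>Ob C.
          Comp C (T0 a) (T0 (T0 a)) (T0 a) (\<epsilon> (T0 a)) (\<delta> a) = Ident C (T0 a) \<and>
          Comp C (T0 a) (T0 (T0 a)) (T0 a) (Fmap T (T0 a) a (\<epsilon> a)) (\<delta> a) = Ident C (T0 a) \<and>
          Comp C (T0 a) (T0 (T0 a)) (T0 (T0 (T0 a))) (\<delta> (T0 a)) (\<delta> a) =
          Comp C (T0 a) (T0 (T0 a)) (T0 (T0 (T0 a))) (Fmap T (T0 a) (T0 (T0 a)) (\<delta> a)) (\<delta> a)))"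

definition comonad_hom ::
  "('o, 'm) cat \<Rightarrow> ('o, 'm) comonad \<Rightarrow> ('o, 'm) comonad \<Rightarrow> ('o \<Rightarrow> 'm) \<Rightarrow> bool" where
  "comonad_hom C K K' \<phi> \<longleftrightarrow>
     (let T = endo K; T' = endo K' in
       nat_trans C C T T' \<phi> \<and>
       vcomp C C T T' id_ftor (counit K') \<phi> = counit K \<and>
       vcomp C C T T' (comp_ftor T' T') (comult K') \<phi> =
       vcomp C C T (comp_ftor T T) (comp_ftor T' T') (hcomp C C T T' T T' \<phi> \<phi>) (comult K))"

definition Comonads :: "('o, 'm) cat \<Rightarrow> (('o, 'm) comonad, 'o \<Rightarrow> 'm) cat" where
  "Comonads C = \<lparr>Ob = {K. is_comonad C K},
     Hom = (\<lambda>K K'. {\<phi>. comonad_hom C K K' \<phi>}),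
     Ident = (\<lambda>K. \<lambda>a\<in>Ob C. Ident C (Fob (endo K) a)),
     Comp = (\<lambda>K K' K''. vcomp C C (endo K) (endo K') (endo K''))\<rparr>"

section \<open>A universe of sets\<close>

text \<open>The totality of all sets is a type \<open>'u\<close>, on which \<open>elts\<close> gives the elements of each set. The
  predicate collects the second-order axioms of ZFC other than infinity (choice holds because it
  does in HOL); with infinity added, it says that \<open>elts\<close> is a model of second-order ZFC.
  Infinity is left out since nothing here depends on it, and then the axioms have a
  model definable in HOL, the hereditarily finite sets (lemma \<open>set_universe_set_decode\<close>).\<close>

definition small :: "('u \<Rightarrow> 'u set) \<Rightarrow> 'u set \<Rightarrow> bool" where
  "small elts A \<longleftrightarrow> A \<in> range elts"

definition set_universe :: "('u \<Rightarrow> 'u set) \<Rightarrow> bool" where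
  "set_universe elts \<longleftrightarrow>
     inj elts \<and>
     wf {(x, y). x \<in> elts y} \<and>
     (\<forall>A B. small elts B \<and> A \<subseteq> B \<longrightarrow> small elts A) \<and>
     (\<forall>A. small elts A \<longrightarrow> small elts (\<Union>x\<in>A. elts x)) \<and>
     (\<forall>A. small elts A \<longrightarrow> small elts {x. elts x \<subseteq> A}) \<and>
     (\<forall>A (f :: 'u \<Rightarrow> 'u). small elts A \<longrightarrow> small elts (f ` A))"

lemma small_set_decode: "small set_decode A \<longleftrightarrow> finite A"
  unfolding small_def by (metis finite_set_decode rangeE rangeI set_encode_inverse)

lemma set_universe_set_decode: "set_universe set_decode"
proof -
  have lt: "x < y" if "x \<in> set_decode y" for x y
  proof -
    have "x < 2 ^ x" by simp
    also have "\<dots> = set_encode {x}" by (simp add: set_encode_def)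
    also have "\<dots> \<le> set_encode (set_decode y)"
      unfolding set_encode_def using that by (intro sum_mono2) auto
    finally show ?thesis by simp
  qed
  have "wf {(x, y). x \<in> set_decode y}"
    by (rule wf_subset[OF wf_less]) (auto intro: lt)
  moreover have "inj set_decode"
    by (metis injI set_decode_inverse)
  moreover have "finite {x. set_decode x \<subseteq> A}" if "finite A" for A
  proof (rule finite_subset)
    show "{x. set_decode x \<subseteq> A} \<subseteq> set_encode ` Pow A"
      by (auto simp: image_iff) (metis PowI set_decode_inverse)
  qed (use that in simp)
  ultimately show ?thesis
    unfolding set_universe_def small_set_decode by (auto intro: finite_subset)
qed

context
  fixes elts :: "'u \<Rightarrow> 'u set"
begin

definition mk_set :: "'u set \<Rightarrow> 'u" where
  "mk_set A = (THE x. elts x = A)"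

definition kpair :: "'u \<Rightarrow> 'u \<Rightarrow> 'u" where
  "kpair x y = mk_set {mk_set {x}, mk_set {x, y}}"

definition lam :: "'u set \<Rightarrow> ('u \<Rightarrow> 'u) \<Rightarrow> 'u" where
  "lam A f = mk_set ((\<lambda>x. kpair x (f x)) ` A)"

definition app :: "'u \<Rightarrow> 'u \<Rightarrow> 'u" where
  "app \<phi> x = (THE y. kpair x y \<in> elts \<phi>)"

definition fun_set :: "'u set \<Rightarrow> 'u \<Rightarrow> 'u" where
  "fun_set A X = mk_set (lam A ` (A \<rightarrow> elts X))"

section \<open>The functor \<open>\<Phi>\<close>\<close>

definition SetCat :: "('u, 'u \<Rightarrow> 'u) cat" where
  "SetCat = \<lparr>Ob = UNIV, Hom = (\<lambda>X Y. elts X \<rightarrow>\<^sub>E elts Y), Ident = (\<lambda>X. \<lambda>x\<in>elts X. x),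
     Comp = (\<lambda>X Y Z g f. compose (elts X) g f)\<rparr>"

text \<open>Two monoid records with the same carrier that differ only outside it are isomorphic objects
  of \<open>Grp\<close> (via the identity), and likewise two comonads in \<open>Comonads C\<close> whose functors differ
  only outside the objects and hom-sets of \<open>C\<close>. Morphisms are extensional.\<close>

definition Grp :: "('u monoid, 'u \<Rightarrow> 'u) cat" where
  "Grp = \<lparr>Ob = {G. group G \<and> small elts (carrier G)},
     Hom = (\<lambda>G H. hom G H \<inter> extensional (carrier G)),
     Ident = (\<lambda>G. \<lambda>x\<in>carrier G. x),
     Comp = (\<lambda>G H L g f. compose (carrier G) g f)\<rparr>"

text \<open>\<open>K_ftor G\<close> is \<open>X \<mapsto> X\<^sup>G\<close>; the function \<open>G \<rightarrow> X\<close> with values \<open>f g\<close> is the element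
  \<open>lam (carrier G) f\<close> of this set.\<close>

definition K_ftor :: "'u monoid \<Rightarrow> ('u, 'u \<Rightarrow> 'u, 'u, 'u \<Rightarrow> 'u) ftor" where
  "K_ftor G = \<lparr>Fob = (\<lambda>X. fun_set (carrier G) X),
     Fmap = (\<lambda>X Y f. \<lambda>\<phi>\<in>elts (fun_set (carrier G) X). lam (carrier G) (\<lambda>g. f (app \<phi> g)))\<rparr>"

definition K_comonad :: "'u monoid \<Rightarrow> ('u, 'u \<Rightarrow> 'u) comonad" where
  "K_comonad G = \<lparr>endo = K_ftor G,
     counit = (\<lambda>X. \<lambda>\<phi>\<in>elts (fun_set (carrier G) X). app \<phi> \<one>\<^bsub>G\<^esub>),
     comult = (\<lambda>X. \<lambda>\<phi>\<in>elts (fun_set (carrier G) X).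
       lam (carrier G) (\<lambda>g. lam (carrier G) (\<lambda>h. app \<phi> (g \<otimes>\<^bsub>G\<^esub> h))))\<rparr>"

definition GrpComonads :: "(('u, 'u \<Rightarrow> 'u) comonad, 'u \<Rightarrow> 'u \<Rightarrow> 'u) cat" where
  "GrpComonads = full_subcat (Comonads SetCat)
     {T. \<exists>G\<in>Ob Grp. isomorphic (Comonads SetCat) T (K_comonad G)}"

text \<open>A morphism from \<open>H\<close> to \<open>G\<close> in \<open>op_cat Grp\<close> is a group morphism \<open>f : G \<rightarrow> H\<close>.\<close>

definition Phi ::
  "('u monoid, 'u \<Rightarrow> 'u, ('u, 'u \<Rightarrow> 'u) comonad, 'u \<Rightarrow> 'u \<Rightarrow> 'u) ftor" where
  "Phi = \<lparr>Fob = K_comonad,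
     Fmap = (\<lambda>H G f. \<lambda>X. \<lambda>\<psi>\<in>elts (fun_set (carrier H) X).
       lam (carrier G) (\<lambda>g. app \<psi> (f g)))\<rparr>"

end

end

theory Submission
  imports Defs
begin

text \<open>As \<open>X \<mapsto> X\<^sup>G\<close> is represented by the set \<open>G\<close>, the Yoneda lemma identifies natural
  transformations \<open>K\<^sub>H \<Rightarrow> K\<^sub>G\<close> with maps \<open>f : G \<rightarrow> H\<close>. Evaluated at the identity of \<open>H\<close>, compatibility
  with the comultiplications becomes \<open>f (g h) = f g f h\<close>, which makes \<open>\<Phi>\<close> fully faithful.
  The objects of \<open>GrpComonads\<close> are exactly the essential image of \<open>\<Phi>\<close>.\<close>

section \<open>Categories and comonads\<close>

text \<open>The Yoneda argument needs the set \<open>carrier H\<close> itself as an object of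
  \<open>SetCat elts\<close>; smallness of carriers in \<open>Grp elts\<close> provides it. There
  the identity of H is an element j of H^H, and every psi in X^H is the image of j under psi, read
  as an arrow from H to X. Hence a natural phi satisfies phi(psi) = psi o f with f = phi(j). The
  comultiplication of K_H sends j to the multiplication table of H, which is why compatibility turns
  into multiplicativity. Since multiplicative maps of groups preserve the unit, Phi(f) is compatible
  with the counits.

  Two kinds of bookkeeping surround this. Functions G -> X have to be elements of a set of the
  universe, so they are coded by their graphs; once \<open>lam\<close> and \<open>app\<close> are
  mutually inverse on function sets, codes compute like functions. And arrows are total HOL
  functions, so equality requires extensionality: an equation splits into one on elements and a
  default value elsewhere.\<close>

context
  fixes C :: "('o, 'm) cat"
  assumes C: "category C"
begin

lemma Ident_in_Hom: "a \<in> Ob C \<Longrightarrow> Ident C a \<in> Hom C a a"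
  using C unfolding category_def by blast

lemma Comp_in_Hom:
  "\<lbrakk>a \<in> Ob C; b \<in> Ob C; c \<in> Ob C; f \<in> Hom C a b; g \<in> Hom C b c\<rbrakk>
    \<Longrightarrow> Comp C a b c g f \<in> Hom C a c"
  using C unfolding category_def by blast

lemma Comp_Ident_right:
  "\<lbrakk>a \<in> Ob C; b \<in> Ob C; f \<in> Hom C a b\<rbrakk> \<Longrightarrow> Comp C a a b f (Ident C a) = f"
  using C unfolding category_def by blast

lemma Comp_Ident_left:
  "\<lbrakk>a \<in> Ob C; b \<in> Ob C; f \<in> Hom C a b\<rbrakk> \<Longrightarrow> Comp C a b b (Ident C b) f = f"
  using C unfolding category_def by blast

text \<open>Oriented opposite to the equation in \<open>category\<close>, so that the simplifier
  moves all brackets to the right.\<close>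

lemma Comp_assoc:
  "\<lbrakk>a \<in> Ob C; b \<in> Ob C; c \<in> Ob C; d \<in> Ob C; f \<in> Hom C a b; g \<in> Hom C b c; h \<in> Hom C c d\<rbrakk>
    \<Longrightarrow> Comp C a b d (Comp C b c d h g) f = Comp C a c d h (Comp C a b c g f)"
  using C unfolding category_def by metis

lemmas category_simps =
  Ident_in_Hom Comp_in_Hom Comp_Ident_right Comp_Ident_left Comp_assoc

end

lemma categoryI:
  assumes "\<And>a. a \<in> Ob C \<Longrightarrow> Ident C a \<in> Hom C a a"
    and "\<And>a b c f g. \<lbrakk>a \<in> Ob C; b \<in> Ob C; c \<in> Ob C; f \<in> Hom C a b; g \<in> Hom C b c\<rbrakk>
      \<Longrightarrow> Comp C a b c g f \<in> Hom C a c"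
    and "\<And>a b f. \<lbrakk>a \<in> Ob C; b \<in> Ob C; f \<in> Hom C a b\<rbrakk> \<Longrightarrow> Comp C a a b f (Ident C a) = f"
    and "\<And>a b f. \<lbrakk>a \<in> Ob C; b \<in> Ob C; f \<in> Hom C a b\<rbrakk> \<Longrightarrow> Comp C a b b (Ident C b) f = f"
    and "\<And>a b c d f g h. \<lbrakk>a \<in> Ob C; b \<in> Ob C; c \<in> Ob C; d \<in> Ob C;
        f \<in> Hom C a b; g \<in> Hom C b c; h \<in> Hom C c d\<rbrakk>
      \<Longrightarrow> Comp C a c d h (Comp C a b c g f) = Comp C a b d (Comp C b c d h g) f"
  shows "category C"
  unfolding category_def using assms by (intro conjI ballI)

lemma is_functorI:
  assumes "category C" "category D"
    and "\<And>a. a \<in> Ob C \<Longrightarrow> Fob F a \<in> Ob D"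
    and "\<And>a b f. \<lbrakk>a \<in> Ob C; b \<in> Ob C; f \<in> Hom C a b\<rbrakk>
      \<Longrightarrow> Fmap F a b f \<in> Hom D (Fob F a) (Fob F b)"
    and "\<And>a. a \<in> Ob C \<Longrightarrow> Fmap F a a (Ident C a) = Ident D (Fob F a)"
    and "\<And>a b c f g. \<lbrakk>a \<in> Ob C; b \<in> Ob C; c \<in> Ob C; f \<in> Hom C a b; g \<in> Hom C b c\<rbrakk>
      \<Longrightarrow> Fmap F a c (Comp C a b c g f) =
        Comp D (Fob F a) (Fob F b) (Fob F c) (Fmap F b c g) (Fmap F a b f)"
  shows "is_functor C D F"
  unfolding is_functor_def using assms by (intro conjI ballI)

context
  fixes C :: "('o, 'm) cat" and D :: "('p, 'n) cat" and F :: "('o, 'm, 'p, 'n) ftor"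
  assumes F: "is_functor C D F"
begin

lemma functor_category_dom: "category C" and functor_category_cod: "category D"
  using F unfolding is_functor_def by auto

lemma Fob_in_Ob: "a \<in> Ob C \<Longrightarrow> Fob F a \<in> Ob D"
  using F unfolding is_functor_def by blast

lemma Fmap_in_Hom:
  "\<lbrakk>a \<in> Ob C; b \<in> Ob C; f \<in> Hom C a b\<rbrakk> \<Longrightarrow> Fmap F a b f \<in> Hom D (Fob F a) (Fob F b)"
  using F unfolding is_functor_def by blast

lemma Fmap_Ident: "a \<in> Ob C \<Longrightarrow> Fmap F a a (Ident C a) = Ident D (Fob F a)"
  using F unfolding is_functor_def by blast

lemma Fmap_Comp:
  "\<lbrakk>a \<in> Ob C; b \<in> Ob C; c \<in> Ob C; f \<in> Hom C a b; g \<in> Hom C b c\<rbrakk>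
    \<Longrightarrow> Fmap F a c (Comp C a b c g f) =
      Comp D (Fob F a) (Fob F b) (Fob F c) (Fmap F b c g) (Fmap F a b f)"
  using F unfolding is_functor_def by blast

lemmas functor_simps = Fob_in_Ob Fmap_in_Hom Fmap_Ident Fmap_Comp

end

lemma is_functor_id: "category C \<Longrightarrow> is_functor C C id_ftor"
  by (rule is_functorI) (auto simp: id_ftor_def)

lemma is_functor_comp:
  assumes F: "is_functor C D F" and G: "is_functor D E G"
  shows "is_functor C E (comp_ftor G F)"
  using functor_category_dom[OF F] functor_category_cod[OF G]
  by (rule is_functorI) (simp_all add: comp_ftor_def functor_simps[OF F] functor_simps[OF G])

lemma nat_transI:
  assumes "is_functor C D F" "is_functor C D G"
    and "\<And>a. a \<in> Ob C \<Longrightarrow> \<eta> a \<in> Hom D (Fob F a) (Fob G a)"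
    and "\<And>a. a \<notin> Ob C \<Longrightarrow> \<eta> a = undefined"
    and "\<And>a b f. \<lbrakk>a \<in> Ob C; b \<in> Ob C; f \<in> Hom C a b\<rbrakk>
      \<Longrightarrow> Comp D (Fob F a) (Fob F b) (Fob G b) (\<eta> b) (Fmap F a b f) =
        Comp D (Fob F a) (Fob G a) (Fob G b) (Fmap G a b f) (\<eta> a)"
  shows "nat_trans C D F G \<eta>"
  unfolding nat_trans_def using assms by (intro conjI ballI PiE_I)

context
  fixes C :: "('o, 'm) cat" and D :: "('p, 'n) cat" and F G :: "('o, 'm, 'p, 'n) ftor" and \<eta>
  assumes \<eta>: "nat_trans C D F G \<eta>"
begin

lemma nat_trans_functor_dom: "is_functor C D F" and nat_trans_functor_cod: "is_functor C D G"
  using \<eta> unfolding nat_trans_def by auto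

lemma nat_trans_in_Hom: "a \<in> Ob C \<Longrightarrow> \<eta> a \<in> Hom D (Fob F a) (Fob G a)"
  using \<eta> unfolding nat_trans_def by blast

text \<open>The unit laws of vertical composition are equations of total functions; this settles the
  arguments outside \<open>Ob C\<close>.\<close>

lemma nat_trans_extensional: "\<eta> \<in> extensional (Ob C)"
  using \<eta> unfolding nat_trans_def PiE_def by blast

lemma naturality:
  "\<lbrakk>a \<in> Ob C; b \<in> Ob C; f \<in> Hom C a b\<rbrakk>
    \<Longrightarrow> Comp D (Fob F a) (Fob F b) (Fob G b) (\<eta> b) (Fmap F a b f) =
      Comp D (Fob F a) (Fob G a) (Fob G b) (Fmap G a b f) (\<eta> a)"
  using \<eta> unfolding nat_trans_def by blast

end

section \<open>Vertical and horizontal composition of natural transformations\<close>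

lemma nat_trans_vcomp:
  assumes \<phi>: "nat_trans C D F G \<phi>" and \<psi>: "nat_trans C D G H \<psi>"
  shows "nat_trans C D F H (vcomp C D F G H \<psi> \<phi>)"
proof -
  note F = nat_trans_functor_dom[OF \<phi>] and G = nat_trans_functor_dom[OF \<psi>]
    and H = nat_trans_functor_cod[OF \<psi>]
  note D = functor_category_cod[OF F]
  note [simp] = category_simps[OF D] functor_simps[OF F] functor_simps[OF G] functor_simps[OF H]
    nat_trans_in_Hom[OF \<phi>] nat_trans_in_Hom[OF \<psi>]
  show ?thesis
  proof (rule nat_transI[OF F H])
    fix a b f assume [simp]: "a \<in> Ob C" "b \<in> Ob C" "f \<in> Hom C a b"
    \<comment> \<open>Pasting of two squares: the square of \<phi> is used here, and the left
      bracketing on the right-hand side exposes the composite to which the square of \<psi> applies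
      next.\<close>
    have "Comp D (Fob F a) (Fob G b) (Fob H b) (\<psi> b)
            (Comp D (Fob F a) (Fob F b) (Fob G b) (\<phi> b) (Fmap F a b f)) =
          Comp D (Fob F a) (Fob G a) (Fob H b)
            (Comp D (Fob G a) (Fob G b) (Fob H b) (\<psi> b) (Fmap G a b f)) (\<phi> a)"
      by (simp add: naturality[OF \<phi>])
    then show "Comp D (Fob F a) (Fob F b) (Fob H b) (vcomp C D F G H \<psi> \<phi> b) (Fmap F a b f) =
        Comp D (Fob F a) (Fob H a) (Fob H b) (Fmap H a b f) (vcomp C D F G H \<psi> \<phi> a)"
      by (simp add: vcomp_def naturality[OF \<psi>])
  qed (simp_all add: vcomp_def)
qed

lemma nat_trans_Ident:
  assumes F: "is_functor C D F"
  shows "nat_trans C D F F (\<lambda>a\<in>Ob C. Ident D (Fob F a))"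
  by (rule nat_transI[OF F F])
    (simp_all add: functor_simps[OF F] category_simps[OF functor_category_cod[OF F]])

lemma vcomp_Ident_right:
  assumes \<phi>: "nat_trans C D F G \<phi>"
  shows "vcomp C D F F G \<phi> (\<lambda>a\<in>Ob C. Ident D (Fob F a)) = \<phi>"
proof -
  note F = nat_trans_functor_dom[OF \<phi>] and G = nat_trans_functor_cod[OF \<phi>]
  show ?thesis
    by (rule extensionalityI[of _ "Ob C"])
      (simp_all add: vcomp_def nat_trans_extensional[OF \<phi>] nat_trans_in_Hom[OF \<phi>]
        functor_simps[OF F] functor_simps[OF G] category_simps[OF functor_category_cod[OF F]])
qed

lemma vcomp_Ident_left:
  assumes \<phi>: "nat_trans C D F G \<phi>"
  shows "vcomp C D F G G (\<lambda>a\<in>Ob C. Ident D (Fob G a)) \<phi> = \<phi>"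
proof -
  note F = nat_trans_functor_dom[OF \<phi>] and G = nat_trans_functor_cod[OF \<phi>]
  show ?thesis
    by (rule extensionalityI[of _ "Ob C"])
      (simp_all add: vcomp_def nat_trans_extensional[OF \<phi>] nat_trans_in_Hom[OF \<phi>]
        functor_simps[OF F] functor_simps[OF G] category_simps[OF functor_category_cod[OF F]])
qed

lemma vcomp_assoc:
  assumes \<phi>: "nat_trans C D F G \<phi>" and \<psi>: "nat_trans C D G H \<psi>" and \<chi>: "nat_trans C D H L \<chi>"
  shows "vcomp C D F G L (vcomp C D G H L \<chi> \<psi>) \<phi> = vcomp C D F H L \<chi> (vcomp C D F G H \<psi> \<phi>)"
proof -
  note F = nat_trans_functor_dom[OF \<phi>] and G = nat_trans_functor_dom[OF \<psi>]
    and H = nat_trans_functor_dom[OF \<chi>] and L = nat_trans_functor_cod[OF \<chi>]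
  show ?thesis
    unfolding vcomp_def
    by (rule restrict_ext)
      (simp add: nat_trans_in_Hom[OF \<phi>] nat_trans_in_Hom[OF \<psi>] nat_trans_in_Hom[OF \<chi>]
        functor_simps[OF F] functor_simps[OF G] functor_simps[OF H] functor_simps[OF L]
        category_simps[OF functor_category_cod[OF F]])
qed

lemma nat_trans_hcomp:
  assumes \<phi>: "nat_trans C D F F' \<phi>" and \<psi>: "nat_trans D E G G' \<psi>"
  shows "nat_trans C E (comp_ftor G F) (comp_ftor G' F') (hcomp C E F F' G G' \<psi> \<phi>)"
proof -
  note F = nat_trans_functor_dom[OF \<phi>] and F' = nat_trans_functor_cod[OF \<phi>]
    and G = nat_trans_functor_dom[OF \<psi>] and G' = nat_trans_functor_cod[OF \<psi>]
  note D = functor_category_cod[OF F] and E = functor_category_cod[OF G]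
  note [simp] = category_simps[OF D] category_simps[OF E]
    functor_simps[OF F] functor_simps[OF F'] functor_simps[OF G] functor_simps[OF G']
    nat_trans_in_Hom[OF \<phi>] nat_trans_in_Hom[OF \<psi>]
  show ?thesis
  proof (rule nat_transI[OF is_functor_comp[OF F G] is_functor_comp[OF F' G']])
    fix a b f assume [simp]: "a \<in> Ob C" "b \<in> Ob C" "f \<in> Hom C a b"
    let ?GFa = "Fob G (Fob F a)" and ?GFb = "Fob G (Fob F b)" and ?GF'a = "Fob G (Fob F' a)"
      and ?GF'b = "Fob G (Fob F' b)" and ?G'F'a = "Fob G' (Fob F' a)" and ?G'F'b = "Fob G' (Fob F' b)"
    \<comment> \<open>This is \<open>Fmap G\<close> of the naturality square of \<phi> at
      \<open>f\<close>; the following equation uses the square of \<psi> at the arrow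
      \<open>Fmap F' a b f\<close>.\<close>
    have "Comp E ?GFa ?GFb ?GF'b (Fmap G (Fob F b) (Fob F' b) (\<phi> b)) (Fmap G (Fob F a) (Fob F b) (Fmap F a b f))
        = Comp E ?GFa ?GF'a ?GF'b (Fmap G (Fob F' a) (Fob F' b) (Fmap F' a b f)) (Fmap G (Fob F a) (Fob F' a) (\<phi> a))"
      using arg_cong[OF naturality[OF \<phi>, of a b f], of "Fmap G (Fob F a) (Fob F' b)"] by simp
    moreover have "Comp E ?GFa ?GF'b ?G'F'b (\<psi> (Fob F' b))
        (Comp E ?GFa ?GF'a ?GF'b (Fmap G (Fob F' a) (Fob F' b) (Fmap F' a b f)) (Fmap G (Fob F a) (Fob F' a) (\<phi> a)))
      = Comp E ?GFa ?GF'a ?G'F'b (Comp E ?GF'a ?G'F'a ?G'F'b (Fmap G' (Fob F' a) (Fob F' b) (Fmap F' a b f)) (\<psi> (Fob F' a)))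
         (Fmap G (Fob F a) (Fob F' a) (\<phi> a))"
      by (simp flip: naturality[OF \<psi>])
    ultimately show "Comp E (Fob (comp_ftor G F) a) (Fob (comp_ftor G F) b) (Fob (comp_ftor G' F') b)
            (hcomp C E F F' G G' \<psi> \<phi> b) (Fmap (comp_ftor G F) a b f) =
          Comp E (Fob (comp_ftor G F) a) (Fob (comp_ftor G' F') a) (Fob (comp_ftor G' F') b)
            (Fmap (comp_ftor G' F') a b f) (hcomp C E F F' G G' \<psi> \<phi> a)"
      by (simp add: hcomp_def comp_ftor_def)
  qed (simp_all add: hcomp_def comp_ftor_def)
qed

text \<open>At an object the two sides differ only in the order of \<psi> and \<phi>' in the middle,
  and they are exchanged by naturality of \<psi> at the arrow \<open>\<phi>' a\<close>. Needed to
  compose comonad morphisms.\<close>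

lemma interchange:
  assumes \<phi>: "nat_trans C D F F' \<phi>" and \<phi>': "nat_trans C D F' F'' \<phi>'"
    and \<psi>: "nat_trans D E G G' \<psi>" and \<psi>': "nat_trans D E G' G'' \<psi>'"
  shows "vcomp C E (comp_ftor G F) (comp_ftor G' F') (comp_ftor G'' F'')
      (hcomp C E F' F'' G' G'' \<psi>' \<phi>') (hcomp C E F F' G G' \<psi> \<phi>) =
    hcomp C E F F'' G G'' (vcomp D E G G' G'' \<psi>' \<psi>) (vcomp C D F F' F'' \<phi>' \<phi>)"
proof -
  note F = nat_trans_functor_dom[OF \<phi>] and F' = nat_trans_functor_cod[OF \<phi>]
    and F'' = nat_trans_functor_cod[OF \<phi>']
    and G = nat_trans_functor_dom[OF \<psi>] and G' = nat_trans_functor_cod[OF \<psi>]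
    and G'' = nat_trans_functor_cod[OF \<psi>']
  note [simp] = category_simps[OF functor_category_cod[OF F]] category_simps[OF functor_category_cod[OF G]]
    functor_simps[OF F] functor_simps[OF F'] functor_simps[OF F'']
    functor_simps[OF G] functor_simps[OF G'] functor_simps[OF G'']
    nat_trans_in_Hom[OF \<phi>] nat_trans_in_Hom[OF \<psi>] nat_trans_in_Hom[OF \<phi>'] nat_trans_in_Hom[OF \<psi>']
  show ?thesis
  proof (rule extensionalityI[of _ "Ob C"])
    fix a assume [simp]: "a \<in> Ob C"
    let ?A = "Fob G (Fob F a)" and ?B = "Fob G (Fob F' a)" and ?B' = "Fob G (Fob F'' a)"
      and ?C = "Fob G' (Fob F' a)" and ?C' = "Fob G' (Fob F'' a)"
    let ?f = "Fmap G (Fob F a) (Fob F' a) (\<phi> a)"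
    have "Comp E ?A ?B ?C' (Comp E ?B ?C ?C' (Fmap G' (Fob F' a) (Fob F'' a) (\<phi>' a)) (\<psi> (Fob F' a))) ?f =
          Comp E ?A ?B ?C' (Comp E ?B ?B' ?C' (\<psi> (Fob F'' a)) (Fmap G (Fob F' a) (Fob F'' a) (\<phi>' a))) ?f"
      by (simp only: naturality[OF \<psi>] functor_simps[OF F'] functor_simps[OF F''] nat_trans_in_Hom[OF \<phi>']
          \<open>a \<in> Ob C\<close>)
    then show "vcomp C E (comp_ftor G F) (comp_ftor G' F') (comp_ftor G'' F'')
        (hcomp C E F' F'' G' G'' \<psi>' \<phi>') (hcomp C E F F' G G' \<psi> \<phi>) a =
      hcomp C E F F'' G G'' (vcomp D E G G' G'' \<psi>' \<psi>) (vcomp C D F F' F'' \<phi>' \<phi>) a"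
      by (simp add: vcomp_def hcomp_def comp_ftor_def)
  qed (simp_all add: vcomp_def hcomp_def)
qed

lemma hcomp_Ident:
  assumes F: "is_functor C D F" and G: "is_functor D E G"
  shows "hcomp C E F F G G (\<lambda>a\<in>Ob D. Ident E (Fob G a)) (\<lambda>a\<in>Ob C. Ident D (Fob F a)) =
    (\<lambda>a\<in>Ob C. Ident E (Fob (comp_ftor G F) a))"
  unfolding hcomp_def
  by (rule restrict_ext)
    (simp add: comp_ftor_def functor_simps[OF F] functor_simps[OF G]
      category_simps[OF functor_category_cod[OF G]])

section \<open>The category of comonads\<close>

lemma comonad_nat_trans:
  assumes "is_comonad C K"
  shows "is_functor C C (endo K)" "nat_trans C C (endo K) id_ftor (counit K)"
    "nat_trans C C (endo K) (comp_ftor (endo K) (endo K)) (comult K)"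
  using assms unfolding is_comonad_def Let_def by auto

lemma comonad_hom_Ident:
  assumes "is_comonad C K"
  shows "comonad_hom C K K (\<lambda>a\<in>Ob C. Ident C (Fob (endo K) a))"
proof -
  note K = comonad_nat_trans[OF assms]
  show ?thesis
    unfolding comonad_hom_def Let_def
    by (simp add: nat_trans_Ident[OF K(1)] vcomp_Ident_right[OF K(2)] vcomp_Ident_right[OF K(3)]
        hcomp_Ident[OF K(1) K(1)] vcomp_Ident_left[OF K(3)])
qed

text \<open>The comultiplication squares of \<phi> and \<psi> are pasted along
  \<open>comult K'\<close>; the horizontal composites \<phi>\<phi> and \<psi>\<psi> then merge into
  one by \<open>interchange\<close>.\<close>

lemma comonad_hom_vcomp:
  assumes K: "is_comonad C K" and K': "is_comonad C K'" and K'': "is_comonad C K''"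
    and \<phi>: "comonad_hom C K K' \<phi>" and \<psi>: "comonad_hom C K' K'' \<psi>"
  shows "comonad_hom C K K'' (vcomp C C (endo K) (endo K') (endo K'') \<psi> \<phi>)"
proof -
  let ?T = "endo K" and ?T' = "endo K'" and ?T'' = "endo K''"
  let ?TT = "comp_ftor ?T ?T" and ?TT' = "comp_ftor ?T' ?T'" and ?TT'' = "comp_ftor ?T'' ?T''"
  have n\<phi>: "nat_trans C C ?T ?T' \<phi>"
    and \<phi>1: "vcomp C C ?T ?T' id_ftor (counit K') \<phi> = counit K"
    and \<phi>2: "vcomp C C ?T ?T' ?TT' (comult K') \<phi>
      = vcomp C C ?T ?TT ?TT' (hcomp C C ?T ?T' ?T ?T' \<phi> \<phi>) (comult K)"
    using \<phi> unfolding comonad_hom_def Let_def by auto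
  have n\<psi>: "nat_trans C C ?T' ?T'' \<psi>"
    and \<psi>1: "vcomp C C ?T' ?T'' id_ftor (counit K'') \<psi> = counit K'"
    and \<psi>2: "vcomp C C ?T' ?T'' ?TT'' (comult K'') \<psi>
      = vcomp C C ?T' ?TT' ?TT'' (hcomp C C ?T' ?T'' ?T' ?T'' \<psi> \<psi>) (comult K')"
    using \<psi> unfolding comonad_hom_def Let_def by auto
  note h\<phi> = nat_trans_hcomp[OF n\<phi> n\<phi>] and h\<psi> = nat_trans_hcomp[OF n\<psi> n\<psi>]
  note c = comonad_nat_trans[OF K] and c' = comonad_nat_trans[OF K'] and c'' = comonad_nat_trans[OF K'']
  show ?thesis
    unfolding comonad_hom_def Let_def
  proof (intro conjI)
    show "vcomp C C ?T ?T'' id_ftor (counit K'') (vcomp C C ?T ?T' ?T'' \<psi> \<phi>) = counit K"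
      by (simp add: \<phi>1 \<psi>1 flip: vcomp_assoc[OF n\<phi> n\<psi> c''(2)])
    have "vcomp C C ?T ?T'' ?TT'' (comult K'') (vcomp C C ?T ?T' ?T'' \<psi> \<phi>) =
      vcomp C C ?T ?TT' ?TT'' (hcomp C C ?T' ?T'' ?T' ?T'' \<psi> \<psi>) (vcomp C C ?T ?T' ?TT' (comult K') \<phi>)"
      by (simp add: \<psi>2 vcomp_assoc[OF n\<phi> c'(3) h\<psi>] flip: vcomp_assoc[OF n\<phi> n\<psi> c''(3)])
    also have "\<dots> = vcomp C C ?T ?TT ?TT'' (vcomp C C ?TT ?TT' ?TT''
        (hcomp C C ?T' ?T'' ?T' ?T'' \<psi> \<psi>) (hcomp C C ?T ?T' ?T ?T' \<phi> \<phi>)) (comult K)"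
      by (simp add: \<phi>2 vcomp_assoc[OF c(3) h\<phi> h\<psi>])
    also have "\<dots> = vcomp C C ?T ?TT ?TT'' (hcomp C C ?T ?T'' ?T ?T''
        (vcomp C C ?T ?T' ?T'' \<psi> \<phi>) (vcomp C C ?T ?T' ?T'' \<psi> \<phi>)) (comult K)"
      by (simp add: interchange[OF n\<phi> n\<psi> n\<phi> n\<psi>])
    finally show "vcomp C C ?T ?T'' ?TT'' (comult K'') (vcomp C C ?T ?T' ?T'' \<psi> \<phi>) = \<dots>" .
  qed (rule nat_trans_vcomp[OF n\<phi> n\<psi>])
qed

lemma comonad_hom_nat_trans: "comonad_hom C K K' \<phi> \<Longrightarrow> nat_trans C C (endo K) (endo K') \<phi>"
  unfolding comonad_hom_def Let_def by auto

text \<open>\<open>is_comonad C K\<close> contains \<open>category C\<close> by way of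
  \<open>is_functor\<close>; over a \<open>C\<close> that is not a category there are simply no
  objects.\<close>

lemma category_Comonads: "category (Comonads C)"
  by (rule categoryI)
    (auto simp: Comonads_def comonad_hom_Ident comonad_hom_vcomp vcomp_Ident_right vcomp_Ident_left
      vcomp_assoc dest!: comonad_hom_nat_trans)

lemma category_op_cat:
  assumes "category C"
  shows "category (op_cat C)"
  by (rule categoryI) (auto simp: op_cat_def category_simps[OF assms])

lemma category_full_subcat:
  assumes "category C"
  shows "category (full_subcat C P)"
  by (rule categoryI) (auto simp: full_subcat_def category_simps[OF assms])

lemma isomorphic_refl:
  assumes "category C" "a \<in> Ob C"
  shows "isomorphic C a a"
  unfolding isomorphic_def cat_iso_def using assms by (metis Ident_in_Hom Comp_Ident_left)

lemma isomorphic_sym: "isomorphic C a b \<Longrightarrow> isomorphic C b a"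
  unfolding isomorphic_def cat_iso_def by blast

section \<open>Fully faithful functors and equivalences\<close>

lemma fully_faithful_full_subcat:
  assumes "fully_faithful C D F" "\<And>a. a \<in> Ob C \<Longrightarrow> Fob F a \<in> P"
  shows "fully_faithful C (full_subcat D P) F"
proof -
  have F: "is_functor C D F"
    using assms(1) unfolding fully_faithful_def by blast
  have "is_functor C (full_subcat D P) F"
    by (rule is_functorI)
      (auto simp: full_subcat_def functor_simps[OF F] assms(2)
        intro: functor_category_dom[OF F]
          category_full_subcat[OF functor_category_cod[OF F], unfolded full_subcat_def])
  with assms(1) show ?thesis
    unfolding fully_faithful_def by (simp add: full_subcat_def)
qed

lemma fully_faithful_obtain:
  assumes "fully_faithful C D F" "a \<in> Ob C" "b \<in> Ob C" "h \<in> Hom D (Fob F a) (Fob F b)"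
  obtains f where "f \<in> Hom C a b" "Fmap F a b f = h"
proof -
  have "h \<in> Fmap F a b ` Hom C a b"
    using assms(1-4) unfolding fully_faithful_def by (metis bij_betw_imp_surj_on)
  then show thesis
    using that by blast
qed

lemma fully_faithful_inject:
  assumes "fully_faithful C D F" "a \<in> Ob C" "b \<in> Ob C" "f \<in> Hom C a b" "g \<in> Hom C a b"
    "Fmap F a b f = Fmap F a b g"
  shows "f = g"
  using assms unfolding fully_faithful_def bij_betw_def by (meson inj_onD)

text \<open>Choice picks for each \<open>d\<close> an object \<open>g d\<close> with mutually
  inverse arrows \<open>e d\<close> and \<open>i d\<close> between \<open>Fob F (g d)\<close> and
  \<open>d\<close>. Fullness then lifts arrows of \<open>D\<close> to \<open>C\<close>, and
  faithfulness lets every equation in \<open>C\<close> be checked after applying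
  \<open>F\<close>.\<close>

theorem fully_faithful_essentially_surjective_equivalence:
  assumes ff: "fully_faithful C D F"
    and ess: "\<And>d. d \<in> Ob D \<Longrightarrow> \<exists>c\<in>Ob C. isomorphic D (Fob F c) d"
  shows "is_equivalence C D F"
proof -
  have F: "is_functor C D F"
    using ff unfolding fully_faithful_def by blast
  note C = functor_category_dom[OF F] and D = functor_category_cod[OF F]
  have "\<forall>d\<in>Ob D. \<exists>c e i. c \<in> Ob C \<and> e \<in> Hom D (Fob F c) d \<and> i \<in> Hom D d (Fob F c) \<and>
      Comp D (Fob F c) d (Fob F c) i e = Ident D (Fob F c) \<and> Comp D d (Fob F c) d e i = Ident D d"
    using ess unfolding isomorphic_def cat_iso_def by meson
  then obtain g e i where g: "\<And>d. d \<in> Ob D \<Longrightarrow> g d \<in> Ob C"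
    and e: "\<And>d. d \<in> Ob D \<Longrightarrow> e d \<in> Hom D (Fob F (g d)) d"
    and i: "\<And>d. d \<in> Ob D \<Longrightarrow> i d \<in> Hom D d (Fob F (g d))"
    and ie: "\<And>d. d \<in> Ob D \<Longrightarrow> Comp D (Fob F (g d)) d (Fob F (g d)) (i d) (e d) = Ident D (Fob F (g d))"
    and ei: "\<And>d. d \<in> Ob D \<Longrightarrow> Comp D d (Fob F (g d)) d (e d) (i d) = Ident D d"
    by metis
  note [simp] = category_simps[OF C] category_simps[OF D] functor_simps[OF F] g e i ie ei
  \<comment> \<open>With brackets moved to the right, \<open>i d\<close> and \<open>e d\<close>
    inside a longer composite no longer form a subterm; this and the next fact cancel them in that
    position.\<close>
  have ie': "Comp D a d (Fob F (g d)) (i d) (Comp D a (Fob F (g d)) d (e d) h) = h"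
    if "a \<in> Ob D" "d \<in> Ob D" "h \<in> Hom D a (Fob F (g d))" for a d h
    using that by (simp flip: Comp_assoc[OF D])
  have ei': "Comp D a (Fob F (g d)) d (e d) (Comp D a d (Fob F (g d)) (i d) h) = h"
    if "a \<in> Ob D" "d \<in> Ob D" "h \<in> Hom D a d" for a d h
    using that by (simp flip: Comp_assoc[OF D])
  \<comment> \<open>The value forced on \<open>Fmap F\<close> of the lifted arrow: naturality of
    \<open>e\<close> requires that \<open>e d'\<close> after it equals \<open>h\<close> after
    \<open>e d\<close>, and composing with \<open>i d'\<close> solves for it.\<close>
  define conj where "conj d d' h = Comp D (Fob F (g d)) d (Fob F (g d')) (Comp D d d' (Fob F (g d')) (i d') h) (e d)"
    for d d' h
  have "\<forall>d d' h. d \<in> Ob D \<longrightarrow> d' \<in> Ob D \<longrightarrow> h \<in> Hom D d d' \<longrightarrow>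
      (\<exists>k. k \<in> Hom C (g d) (g d') \<and> Fmap F (g d) (g d') k = conj d d' h)"
  proof (intro allI impI)
    fix d d' h assume a: "d \<in> Ob D" "d' \<in> Ob D" "h \<in> Hom D d d'"
    then have "conj d d' h \<in> Hom D (Fob F (g d)) (Fob F (g d'))"
      by (simp add: conj_def)
    with a show "\<exists>k. k \<in> Hom C (g d) (g d') \<and> Fmap F (g d) (g d') k = conj d d' h"
      using fully_faithful_obtain[OF ff] g by metis
  qed
  then obtain gm where gm [simp]: "\<And>d d' h. \<lbrakk>d \<in> Ob D; d' \<in> Ob D; h \<in> Hom D d d'\<rbrakk>
      \<Longrightarrow> gm d d' h \<in> Hom C (g d) (g d')"
    and Fgm [simp]: "\<And>d d' h. \<lbrakk>d \<in> Ob D; d' \<in> Ob D; h \<in> Hom D d d'\<rbrakk>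
      \<Longrightarrow> Fmap F (g d) (g d') (gm d d' h) = conj d d' h"
    by metis
  define G where "G = \<lparr>Fob = g, Fmap = gm\<rparr>"
  have [simp]: "Fob G = g" "Fmap G = gm"
    by (simp_all add: G_def)
  have G: "is_functor D C G"
  proof (rule is_functorI[OF D C])
    fix a assume [simp]: "a \<in> Ob D"
    show "Fmap G a a (Ident D a) = Ident C (Fob G a)"
      by (rule fully_faithful_inject[OF ff, of "g a" "g a"]) (simp_all add: conj_def)
  next
    fix a b c f h
    assume [simp]: "a \<in> Ob D" "b \<in> Ob D" "c \<in> Ob D" "f \<in> Hom D a b" "h \<in> Hom D b c"
    show "Fmap G a c (Comp D a b c h f) = Comp C (Fob G a) (Fob G b) (Fob G c) (Fmap G b c h) (Fmap G a b f)"
      by (rule fully_faithful_inject[OF ff, of "g a" "g c"]) (simp_all add: conj_def ei')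
  qed simp_all
  \<comment> \<open>The unit: \<open>n c\<close> lifts the arrow \<open>i\<close> at the object
    \<open>Fob F c\<close>, and its inverse \<open>m c\<close> lifts \<open>e\<close> there.\<close>
  have "\<forall>c\<in>Ob C. \<exists>n. n \<in> Hom C c (g (Fob F c)) \<and> Fmap F c (g (Fob F c)) n = i (Fob F c)"
    using fully_faithful_obtain[OF ff] g i Fob_in_Ob[OF F] by metis
  then obtain n where n [simp]: "\<And>c. c \<in> Ob C \<Longrightarrow> n c \<in> Hom C c (g (Fob F c))"
    and Fn [simp]: "\<And>c. c \<in> Ob C \<Longrightarrow> Fmap F c (g (Fob F c)) (n c) = i (Fob F c)"
    by metis
  have "\<forall>c\<in>Ob C. \<exists>m. m \<in> Hom C (g (Fob F c)) c \<and> Fmap F (g (Fob F c)) c m = e (Fob F c)"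
    using fully_faithful_obtain[OF ff] g e Fob_in_Ob[OF F] by metis
  then obtain m where m [simp]: "\<And>c. c \<in> Ob C \<Longrightarrow> m c \<in> Hom C (g (Fob F c)) c"
    and Fm [simp]: "\<And>c. c \<in> Ob C \<Longrightarrow> Fmap F (g (Fob F c)) c (m c) = e (Fob F c)"
    by metis
  have "nat_iso C C id_ftor (comp_ftor G F) (\<lambda>c\<in>Ob C. n c)"
    unfolding nat_iso_def
  proof (intro conjI ballI nat_transI is_functor_id is_functor_comp[OF F G] C)
    fix a b f assume [simp]: "a \<in> Ob C" "b \<in> Ob C" "f \<in> Hom C a b"
    have "Comp C a b (g (Fob F b)) (n b) f =
        Comp C a (g (Fob F a)) (g (Fob F b)) (gm (Fob F a) (Fob F b) (Fmap F a b f)) (n a)"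
      by (rule fully_faithful_inject[OF ff, of a "g (Fob F b)"]) (simp_all add: conj_def)
    then show "Comp C (Fob id_ftor a) (Fob id_ftor b) (Fob (comp_ftor G F) b)
          ((\<lambda>c\<in>Ob C. n c) b) (Fmap id_ftor a b f) =
        Comp C (Fob id_ftor a) (Fob (comp_ftor G F) a) (Fob (comp_ftor G F) b)
          (Fmap (comp_ftor G F) a b f) ((\<lambda>c\<in>Ob C. n c) a)"
      by (simp add: id_ftor_def comp_ftor_def)
  next
    fix a assume [simp]: "a \<in> Ob C"
    have "Comp C a (g (Fob F a)) a (m a) (n a) = Ident C a"
      by (rule fully_faithful_inject[OF ff, of a a]) simp_all
    moreover have "Comp C (g (Fob F a)) a (g (Fob F a)) (n a) (m a) = Ident C (g (Fob F a))"
      by (rule fully_faithful_inject[OF ff, of "g (Fob F a)" "g (Fob F a)"]) simp_all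
    ultimately show "cat_iso C (Fob id_ftor a) (Fob (comp_ftor G F) a) ((\<lambda>c\<in>Ob C. n c) a)"
      unfolding cat_iso_def id_ftor_def comp_ftor_def by (auto intro: bexI[of _ "m a"])
  qed (simp_all add: id_ftor_def comp_ftor_def)
  moreover have "nat_iso D D (comp_ftor F G) id_ftor (\<lambda>d\<in>Ob D. e d)"
    unfolding nat_iso_def
  proof (intro conjI ballI nat_transI is_functor_id is_functor_comp[OF G F] D)
    fix d assume [simp]: "d \<in> Ob D"
    show "cat_iso D (Fob (comp_ftor F G) d) (Fob id_ftor d) ((\<lambda>d\<in>Ob D. e d) d)"
      unfolding cat_iso_def id_ftor_def comp_ftor_def by (auto intro: bexI[of _ "i d"])
  qed (simp_all add: id_ftor_def comp_ftor_def conj_def ei')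
  ultimately show ?thesis
    unfolding is_equivalence_def using F G by blast
qed

section \<open>Sets and groups\<close>

lemma SetCat_simps:
  "Ob (SetCat elts) = UNIV" "Hom (SetCat elts) X Y = elts X \<rightarrow>\<^sub>E elts Y"
  "Ident (SetCat elts) X = (\<lambda>x\<in>elts X. x)" "Comp (SetCat elts) X Y Z g f = compose (elts X) g f"
  by (simp_all add: SetCat_def)

lemma category_SetCat: "category (SetCat elts)"
  by (rule categoryI) (auto simp: SetCat_simps compose_def fun_eq_iff restrict_def)

lemma category_Grp:
  fixes elts :: "'u \<Rightarrow> 'u set"
  shows "category (Grp elts)"
proof (rule categoryI)
  fix a :: "'u monoid" assume "a \<in> Ob (Grp elts)"
  then show "Ident (Grp elts) a \<in> Hom (Grp elts) a a"
    by (auto simp: Grp_def hom_def group.is_monoid monoid.m_closed)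
next
  fix a b c :: "'u monoid" and f g
  assume "a \<in> Ob (Grp elts)" "b \<in> Ob (Grp elts)" "c \<in> Ob (Grp elts)"
    "f \<in> Hom (Grp elts) a b" "g \<in> Hom (Grp elts) b c"
  then show "Comp (Grp elts) a b c g f \<in> Hom (Grp elts) a c"
    by (auto simp: Grp_def hom_def compose_def Pi_iff group.is_monoid monoid.m_closed)
qed (auto simp: Grp_def hom_def compose_def extensional_def fun_eq_iff restrict_def)

text \<open>Both composites in a naturality square are restricted to the same set, so comparing them
  on its elements suffices. This removes \<open>compose\<close> from all later computations.\<close>

lemma nat_trans_SetCat_iff:
  "nat_trans (SetCat elts) (SetCat elts) F G \<eta> \<longleftrightarrow>
    is_functor (SetCat elts) (SetCat elts) F \<and> is_functor (SetCat elts) (SetCat elts) G \<and>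
    (\<forall>X. \<eta> X \<in> elts (Fob F X) \<rightarrow>\<^sub>E elts (Fob G X)) \<and>
    (\<forall>X Y. \<forall>f \<in> elts X \<rightarrow>\<^sub>E elts Y. \<forall>x\<in>elts (Fob F X).
      \<eta> Y (Fmap F X Y f x) = Fmap G X Y f (\<eta> X x))"
  unfolding nat_trans_def
  by (auto simp: SetCat_simps compose_def fun_eq_iff restrict_def PiE_iff[where I = UNIV])

text \<open>That \<open>K\<close> is a comonad makes its counit and comultiplication extensional, so
  equations between families of functions reduce to elements; it also places
  \<open>comult K X x\<close> in the set on which the horizontal composite is evaluated.\<close>

lemma comonad_hom_SetCat_iff:
  assumes K: "is_comonad (SetCat elts) K"
  shows "comonad_hom (SetCat elts) K K' \<phi> \<longleftrightarrow>
    nat_trans (SetCat elts) (SetCat elts) (endo K) (endo K') \<phi> \<and>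
    (\<forall>X. \<forall>x\<in>elts (Fob (endo K) X).
      counit K' X (\<phi> X x) = counit K X x \<and>
      comult K' X (\<phi> X x) = \<phi> (Fob (endo K') X)
        (Fmap (endo K) (Fob (endo K) X) (Fob (endo K') X) (\<phi> X) (comult K X x)))"
proof -
  have "counit K X \<in> extensional (elts (Fob (endo K) X))"
    "comult K X \<in> elts (Fob (endo K) X) \<rightarrow>\<^sub>E elts (Fob (endo K) (Fob (endo K) X))" for X
    using comonad_nat_trans(2,3)[OF K]
    by (auto simp: nat_trans_SetCat_iff id_ftor_def comp_ftor_def PiE_iff)
  then show ?thesis
    unfolding comonad_hom_def Let_def
    by (auto simp: vcomp_def hcomp_def SetCat_simps compose_def comp_ftor_def fun_eq_iff restrict_def
        extensional_def PiE_iff)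
qed

lemma Fob_K_ftor: "Fob (K_ftor elts G) X = fun_set elts (carrier G) X"
  by (simp add: K_ftor_def)

lemma Fmap_K_ftor:
  "\<phi> \<in> elts (fun_set elts (carrier G) X) \<Longrightarrow>
    Fmap (K_ftor elts G) X Y f \<phi> = lam elts (carrier G) (\<lambda>g. f (app elts \<phi> g))"
  by (simp add: K_ftor_def)

lemma K_comonad_simps:
  "endo (K_comonad elts G) = K_ftor elts G"
  "\<phi> \<in> elts (fun_set elts (carrier G) X) \<Longrightarrow> counit (K_comonad elts G) X \<phi> = app elts \<phi> \<one>\<^bsub>G\<^esub>"
  "\<phi> \<in> elts (fun_set elts (carrier G) X) \<Longrightarrow> comult (K_comonad elts G) X \<phi> =
    lam elts (carrier G) (\<lambda>g. lam elts (carrier G) (\<lambda>h. app elts \<phi> (g \<otimes>\<^bsub>G\<^esub> h)))"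
  by (simp_all add: K_comonad_def)

lemma Phi_simps:
  "Fob (Phi elts) = K_comonad elts"
  "\<psi> \<in> elts (fun_set elts (carrier H) X) \<Longrightarrow>
    Fmap (Phi elts) H G f X \<psi> = lam elts (carrier G) (\<lambda>g. app elts \<psi> (f g))"
  by (simp_all add: Phi_def)

lemma lam_cong: "(\<And>x. x \<in> A \<Longrightarrow> f x = g x) \<Longrightarrow> lam elts A f = lam elts A g"
  unfolding lam_def by (rule arg_cong[of _ _ "mk_set elts"]) auto

section \<open>Function sets in a universe\<close>

context
  fixes elts :: "'u \<Rightarrow> 'u set"
  assumes univ: "set_universe elts"
begin

section \<open>Smallness, pairs and graphs of functions\<close>

lemma small_elts: "small elts (elts x)"
  by (simp add: small_def)

lemma small_subset: "small elts B \<Longrightarrow> A \<subseteq> B \<Longrightarrow> small elts A"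
  using univ unfolding set_universe_def by blast

lemma small_Union: "small elts A \<Longrightarrow> small elts (\<Union>x\<in>A. elts x)"
  using univ unfolding set_universe_def by blast

lemma small_Pow: "small elts A \<Longrightarrow> small elts {x. elts x \<subseteq> A}"
  using univ unfolding set_universe_def by blast

lemma small_image: "small elts A \<Longrightarrow> small elts (f ` A)" for f :: "'u \<Rightarrow> 'u"
  using univ unfolding set_universe_def by blast

lemma elts_mk_set: "small elts A \<Longrightarrow> elts (mk_set elts A) = A"
proof -
  assume "small elts A"
  then obtain x where x: "elts x = A"
    unfolding small_def by blast
  have "inj elts"
    using univ unfolding set_universe_def by blast
  with x show ?thesis
    unfolding mk_set_def by (metis (mono_tags, lifting) injD theI)
qed

text \<open>The set of subsets of the singleton of the empty set has two elements, so that
  replacement yields all pairs.\<close>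

lemma small_pair: "small elts {x, y}"
proof -
  have "small elts {}"
    by (rule small_subset[OF small_elts]) simp
  define o0 where "o0 = mk_set elts {}"
  have o0: "elts o0 = {}"
    using elts_mk_set[OF \<open>small elts {}\<close>] by (simp add: o0_def)
  have "small elts {o0}"
    by (rule small_subset[OF small_Pow[OF \<open>small elts {}\<close>]]) (simp add: o0)
  define o1 where "o1 = mk_set elts {o0}"
  have o1: "elts o1 = {o0}"
    using elts_mk_set[OF \<open>small elts {o0}\<close>] by (simp add: o1_def)
  have "small elts {o0, o1}"
    by (rule small_subset[OF small_Pow[OF \<open>small elts {o0}\<close>]]) (simp add: o0 o1)
  then have "small elts ((\<lambda>z. if z = o0 then x else y) ` {o0, o1})"
    by (rule small_image)
  moreover have "o1 \<noteq> o0"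
    using o0 o1 by auto
  ultimately show ?thesis
    by (simp add: insert_commute)
qed

lemma small_singleton: "small elts {x}"
  using small_pair[of x x] by simp

lemma kpair_inject: "kpair elts x y = kpair elts x' y' \<longleftrightarrow> x = x' \<and> y = y'"
proof
  assume "kpair elts x y = kpair elts x' y'"
  then have "{mk_set elts {x}, mk_set elts {x, y}} = {mk_set elts {x'}, mk_set elts {x', y'}}"
    unfolding kpair_def by (metis elts_mk_set small_pair)
  \<comment> \<open>Decoding the inner sets yields Kuratowski's equation between genuine sets of
    sets.\<close>
  then have "elts ` {mk_set elts {x}, mk_set elts {x, y}} = elts ` {mk_set elts {x'}, mk_set elts {x', y'}}"
    by (rule arg_cong)
  then have "{{x}, {x, y}} = {{x'}, {x', y'}}"
    by (simp add: elts_mk_set small_pair small_singleton)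
  then show "x = x' \<and> y = y'"
    by (auto simp: doubleton_eq_iff)
qed simp

lemma elts_lam: "small elts A \<Longrightarrow> elts (lam elts A f) = (\<lambda>x. kpair elts x (f x)) ` A"
  unfolding lam_def by (intro elts_mk_set small_image)

lemma app_lam: "small elts A \<Longrightarrow> x \<in> A \<Longrightarrow> app elts (lam elts A f) x = f x"
  unfolding app_def by (auto simp: elts_lam kpair_inject)

text \<open>Each graph is a subset of the product of \<open>A\<close> and \<open>elts X\<close>, so
  it lies in the power set of that product. The product \<open>P\<close> is small by replacement and
  union: it is the union over \<open>x\<close> in \<open>A\<close> of the images of
  \<open>elts X\<close> under \<open>kpair elts x\<close>.\<close>

lemma small_lam_image: "small elts A \<Longrightarrow> small elts (lam elts A ` (A \<rightarrow> elts X))"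
proof -
  assume A: "small elts A"
  define P where "P = (\<Union>z \<in> (\<lambda>x. mk_set elts (kpair elts x ` elts X)) ` A. elts z)"
  have "small elts P"
    unfolding P_def by (intro small_Union small_image A)
  moreover have "P = (\<Union>x\<in>A. kpair elts x ` elts X)"
    unfolding P_def by (simp add: elts_mk_set small_image small_elts)
  then have "lam elts A ` (A \<rightarrow> elts X) \<subseteq> {z. elts z \<subseteq> P}"
    using A by (fastforce simp: elts_lam)
  ultimately show ?thesis
    by (blast intro: small_subset small_Pow)
qed

context
  fixes A :: "'u set"
  assumes A: "small elts A"
begin

lemma elts_fun_set: "elts (fun_set elts A X) = lam elts A ` (A \<rightarrow> elts X)"
  unfolding fun_set_def by (rule elts_mk_set[OF small_lam_image[OF A]])

lemma lam_in_fun_set: "(\<And>x. x \<in> A \<Longrightarrow> f x \<in> elts X) \<Longrightarrow> lam elts A f \<in> elts (fun_set elts A X)"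
  by (auto simp: elts_fun_set)

lemma app_in_elts: "\<phi> \<in> elts (fun_set elts A X) \<Longrightarrow> x \<in> A \<Longrightarrow> app elts \<phi> x \<in> elts X"
  by (auto simp: elts_fun_set app_lam[OF A])

text \<open>The eta rule matching the beta rule \<open>app_lam\<close>: a function set contains
  nothing but codes of functions.\<close>

lemma lam_app: "\<phi> \<in> elts (fun_set elts A X) \<Longrightarrow> lam elts A (app elts \<phi>) = \<phi>"
  by (auto simp: elts_fun_set app_lam[OF A] intro: lam_cong)

lemma lam_comp_in_fun_set:
  "\<phi> \<in> elts (fun_set elts A X) \<Longrightarrow> f \<in> elts X \<rightarrow>\<^sub>E elts Y \<Longrightarrow>
    lam elts A (\<lambda>x. f (app elts \<phi> x)) \<in> elts (fun_set elts A Y)"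
  by (intro lam_in_fun_set) (auto dest: app_in_elts)

lemma lam_eq_iff: "lam elts A f = lam elts A g \<longleftrightarrow> (\<forall>x\<in>A. f x = g x)"
  by (metis app_lam[OF A] lam_cong)

end

section \<open>The comonads of groups\<close>

lemma is_functor_K_ftor:
  assumes G: "small elts (carrier G)"
  shows "is_functor (SetCat elts) (SetCat elts) (K_ftor elts G)"
proof (rule is_functorI[OF category_SetCat category_SetCat])
  fix X Y f assume "f \<in> Hom (SetCat elts) X Y"
  then show "Fmap (K_ftor elts G) X Y f \<in> Hom (SetCat elts) (Fob (K_ftor elts G) X) (Fob (K_ftor elts G) Y)"
    by (auto simp: SetCat_simps K_ftor_def intro!: lam_in_fun_set[OF G] intro: app_in_elts[OF G])
next
  fix X
  \<comment> \<open>Only the right-hand \<phi> is expanded by the eta rule, so that both sides are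
    \<open>lam\<close> terms that can be compared pointwise.\<close>
  have "lam elts (carrier G) (\<lambda>g. restrict (\<lambda>x. x) (elts X) (app elts \<phi> g)) = \<phi>"
    if "\<phi> \<in> elts (fun_set elts (carrier G) X)" for \<phi>
    using that by (subst (2) lam_app[OF G that, symmetric]) (auto intro!: lam_cong dest: app_in_elts[OF G])
  then show "Fmap (K_ftor elts G) X X (Ident (SetCat elts) X) = Ident (SetCat elts) (Fob (K_ftor elts G) X)"
    by (auto simp: SetCat_simps K_ftor_def)
next
  fix X Y Z f g assume "f \<in> Hom (SetCat elts) X Y" "g \<in> Hom (SetCat elts) Y Z"
  then show "Fmap (K_ftor elts G) X Z (Comp (SetCat elts) X Y Z g f) =
      Comp (SetCat elts) (Fob (K_ftor elts G) X) (Fob (K_ftor elts G) Y) (Fob (K_ftor elts G) Z)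
        (Fmap (K_ftor elts G) Y Z g) (Fmap (K_ftor elts G) X Y f)"
    unfolding SetCat_simps Fob_K_ftor
    by (auto simp: K_ftor_def compose_def lam_comp_in_fun_set[OF G] app_in_elts[OF G] app_lam[OF G]
      PiE_mem fun_eq_iff restrict_def intro!: lam_cong)
qed (simp add: SetCat_simps)

text \<open>On elements the counit laws are the left and right unit laws of \<open>G\<close>, and
  coassociativity compares the values at (gh)k and g(hk).\<close>

lemma is_comonad_K_comonad:
  assumes "group G" and G: "small elts (carrier G)"
  shows "is_comonad (SetCat elts) (K_comonad elts G)"
proof -
  interpret group G by fact
  note [simp] = app_lam[OF G] lam_in_fun_set[OF G] app_in_elts[OF G] lam_app[OF G] lam_eq_iff[OF G]
    lam_comp_in_fun_set[OF G]
    Fob_K_ftor Fmap_K_ftor K_comonad_simps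
  let ?S = "SetCat elts" and ?K = "K_comonad elts G"
  note F = is_functor_K_ftor[OF G]
  have "nat_trans ?S ?S (endo ?K) id_ftor (counit ?K)"
    unfolding nat_trans_SetCat_iff K_comonad_simps(1)
    by (intro conjI F is_functor_id category_SetCat) (auto simp: id_ftor_def K_comonad_def PiE_mem)
  moreover have "nat_trans ?S ?S (endo ?K) (comp_ftor (endo ?K) (endo ?K)) (comult ?K)"
    unfolding nat_trans_SetCat_iff K_comonad_simps(1)
    by (intro conjI F is_functor_comp[OF F F]) (auto simp: comp_ftor_def K_comonad_def PiE_mem)
  ultimately show ?thesis
    unfolding is_comonad_def Let_def
    by (auto simp: F SetCat_simps compose_def fun_eq_iff restrict_def m_assoc K_comonad_def cong: lam_cong)
qed

text \<open>Naturality holds because precomposition commutes with postcomposition. The counit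
  condition is preservation of the unit by \<open>f\<close>, and the comultiplication condition is
  multiplicativity.\<close>

lemma comonad_hom_Phi:
  assumes "group G" and G: "small elts (carrier G)" and "group H" and H: "small elts (carrier H)"
    and f: "f \<in> hom G H"
  shows "comonad_hom (SetCat elts) (K_comonad elts H) (K_comonad elts G) (Fmap (Phi elts) H G f)"
proof -
  interpret G: group G by fact
  interpret H: group H by fact
  interpret f: group_hom G H f by unfold_locales fact
  have [simp]: "f g \<in> carrier H" if "g \<in> carrier G" for g
    using f that by (auto simp: hom_def)
  note [simp] = app_lam[OF G] lam_in_fun_set[OF G] app_in_elts[OF G] lam_app[OF G] lam_eq_iff[OF G]
    lam_comp_in_fun_set[OF G]
    app_lam[OF H] lam_in_fun_set[OF H] app_in_elts[OF H] lam_app[OF H] lam_eq_iff[OF H]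
    lam_comp_in_fun_set[OF H]
    Fob_K_ftor Fmap_K_ftor K_comonad_simps
    Phi_simps
  show ?thesis
    unfolding comonad_hom_SetCat_iff[OF is_comonad_K_comonad[OF \<open>group H\<close> H]] nat_trans_SetCat_iff
    by (auto simp: is_functor_K_ftor[OF G] is_functor_K_ftor[OF H] PiE_mem)
       (auto simp: Phi_def)
qed

text \<open>The Yoneda argument: by naturality a transformation is determined by its value on the
  identity of \<open>carrier H\<close>, seen as an element of \<open>H\<^sup>H\<close>.\<close>

lemma comonad_hom_Phi_surj:
  assumes "group G" and G: "small elts (carrier G)" and "group H" and H: "small elts (carrier H)"
    and \<phi>: "comonad_hom (SetCat elts) (K_comonad elts H) (K_comonad elts G) \<phi>"
  obtains f where "f \<in> hom G H \<inter> extensional (carrier G)" "Fmap (Phi elts) H G f = \<phi>"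
proof -
  interpret G: group G by fact
  interpret H: group H by fact
  note [simp] = app_lam[OF G] lam_in_fun_set[OF G] app_in_elts[OF G] lam_app[OF G] lam_eq_iff[OF G]
    lam_comp_in_fun_set[OF G]
    app_lam[OF H] lam_in_fun_set[OF H] app_in_elts[OF H] lam_app[OF H] lam_eq_iff[OF H]
    lam_comp_in_fun_set[OF H]
    Fob_K_ftor Fmap_K_ftor K_comonad_simps
    Phi_simps
  have \<phi>_PiE: "\<And>X. \<phi> X \<in> elts (fun_set elts (carrier H) X) \<rightarrow>\<^sub>E elts (fun_set elts (carrier G) X)"
    and nat: "\<And>X Y h \<psi>. h \<in> elts X \<rightarrow>\<^sub>E elts Y \<Longrightarrow> \<psi> \<in> elts (fun_set elts (carrier H) X) \<Longrightarrow>
      \<phi> Y (Fmap (K_ftor elts H) X Y h \<psi>) = Fmap (K_ftor elts G) X Y h (\<phi> X \<psi>)"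
    and mult: "\<And>X \<psi>. \<psi> \<in> elts (fun_set elts (carrier H) X) \<Longrightarrow>
      comult (K_comonad elts G) X (\<phi> X \<psi>) = \<phi> (fun_set elts (carrier G) X)
        (Fmap (K_ftor elts H) (fun_set elts (carrier H) X) (fun_set elts (carrier G) X) (\<phi> X)
          (comult (K_comonad elts H) X \<psi>))"
    using \<phi>
    unfolding comonad_hom_SetCat_iff[OF is_comonad_K_comonad[OF \<open>group H\<close> H]] nat_trans_SetCat_iff
      K_comonad_simps(1) Fob_K_ftor by blast+
  have [simp]: "\<phi> X \<psi> \<in> elts (fun_set elts (carrier G) X)" if "\<psi> \<in> elts (fun_set elts (carrier H) X)" for X \<psi>
    using \<phi>_PiE that by (rule PiE_mem)
  define U where "U = mk_set elts (carrier H)"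
  have U: "elts U = carrier H"
    by (simp add: U_def elts_mk_set H)
  define j where "j = lam elts (carrier H) (\<lambda>x. x)"
  have j: "j \<in> elts (fun_set elts (carrier H) U)"
    by (simp add: j_def U)
  define f where "f = (\<lambda>g\<in>carrier G. app elts (\<phi> U j) g)"
  have f_in [simp]: "f g \<in> carrier H" if "g \<in> carrier G" for g
    using that app_in_elts[OF G PiE_mem[OF \<phi>_PiE j]] by (simp add: f_def U)
  have \<phi>_eq: "\<phi> X \<psi> = lam elts (carrier G) (\<lambda>g. app elts \<psi> (f g))"
    if \<psi>: "\<psi> \<in> elts (fun_set elts (carrier H) X)" for X \<psi>
  proof -
    \<comment> \<open>Naturality is applied to \<psi> read as an arrow from \<open>U\<close> to
      \<open>X\<close>, where arrows must be extensional. It carries \<open>j\<close> to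
      \<psi>.\<close>
    have "restrict (app elts \<psi>) (carrier H) \<in> elts U \<rightarrow>\<^sub>E elts X"
      using \<psi> by (auto simp: U)
    from nat[OF this j] have "\<phi> X (lam elts (carrier H) (\<lambda>x. restrict (app elts \<psi>) (carrier H) (app elts j x))) =
        lam elts (carrier G) (\<lambda>g. restrict (app elts \<psi>) (carrier H) (app elts (\<phi> U j) g))"
      using j by simp
    moreover have "lam elts (carrier H) (\<lambda>x. restrict (app elts \<psi>) (carrier H) (app elts j x)) = \<psi>"
      using \<psi> by (subst (2) lam_app[OF H \<psi>, symmetric]) (simp add: j_def del: lam_app[OF H])
    moreover have "lam elts (carrier G) (\<lambda>g. restrict (app elts \<psi>) (carrier H) (app elts (\<phi> U j) g)) =
        lam elts (carrier G) (\<lambda>g. app elts \<psi> (f g))"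
      using f_in by (intro lam_cong) (auto simp: f_def)
    ultimately show ?thesis
      by simp
  qed
  have "f \<in> hom G H"
  proof (rule homI)
    fix g h assume gh: "g \<in> carrier G" "h \<in> carrier G"
    \<comment> \<open>Both sides of the comultiplication condition at \<open>j\<close>: \<phi>
      followed by the comultiplication of \<open>G\<close> gives f(gh), while two uses of
      \<open>\<phi>_eq\<close> on the multiplication table of \<open>H\<close> substitute
      \<open>f g\<close> and \<open>f h\<close> into it.\<close>
    have "lam elts (carrier G) (\<lambda>g. lam elts (carrier G) (\<lambda>h. f (g \<otimes>\<^bsub>G\<^esub> h))) =
      lam elts (carrier G) (\<lambda>g. lam elts (carrier G) (\<lambda>h. f g \<otimes>\<^bsub>H\<^esub> f h))"
      using mult[OF j] j by (simp add: \<phi>_eq U j_def cong: lam_cong)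
    with gh show "f (g \<otimes>\<^bsub>G\<^esub> h) = f g \<otimes>\<^bsub>H\<^esub> f h"
      by simp
  qed simp
  moreover have "Fmap (Phi elts) H G f = \<phi>"
  proof (rule ext)
    fix X
    show "Fmap (Phi elts) H G f X = \<phi> X"
      by (rule extensionalityI[of _ "elts (fun_set elts (carrier H) X)"])
        (use \<phi>_PiE in \<open>auto simp: Phi_def \<phi>_eq PiE_def\<close>)
  qed
  ultimately show thesis
    using that by (auto simp: f_def)
qed

text \<open>Precomposing the code \<open>j\<close> of the identity with \<open>f\<close> returns the
  code of \<open>f\<close>, from which the values of \<open>f\<close> can be read off.\<close>

lemma Phi_inj:
  assumes "group G" and G: "small elts (carrier G)" and "group H" and H: "small elts (carrier H)"
    and f: "f \<in> hom G H \<inter> extensional (carrier G)" and f': "f' \<in> hom G H \<inter> extensional (carrier G)"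
    and eq: "Fmap (Phi elts) H G f = Fmap (Phi elts) H G f'"
  shows "f = f'"
proof (rule extensionalityI[of _ "carrier G"])
  fix g assume g: "g \<in> carrier G"
  define j where "j = lam elts (carrier H) (\<lambda>x. x)"
  have "j \<in> elts (fun_set elts (carrier H) (mk_set elts (carrier H)))"
    by (simp add: j_def lam_in_fun_set[OF H] elts_mk_set H)
  then have "lam elts (carrier G) (\<lambda>g. app elts j (f g)) = lam elts (carrier G) (\<lambda>g. app elts j (f' g))"
    using eq by (metis Phi_simps(2))
  then show "f g = f' g"
    using g f f' by (auto simp: lam_eq_iff[OF G] j_def app_lam[OF H] hom_def Pi_iff)
qed (use f f' in auto)

section \<open>Full faithfulness and the equivalence\<close>

lemma fully_faithful_Phi: "fully_faithful (op_cat (Grp elts)) (Comonads (SetCat elts)) (Phi elts)"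
proof -
  have simps: "Ob (op_cat (Grp elts)) = {G. group G \<and> small elts (carrier G)}"
    "Hom (op_cat (Grp elts)) H G = hom G H \<inter> extensional (carrier G)"
    "Ident (op_cat (Grp elts)) G = (\<lambda>x\<in>carrier G. x)"
    "Comp (op_cat (Grp elts)) L H G f g = compose (carrier G) g f"
    "Ob (Comonads (SetCat elts)) = {K. is_comonad (SetCat elts) K}"
    "Hom (Comonads (SetCat elts)) K K' = {\<phi>. comonad_hom (SetCat elts) K K' \<phi>}"
    for G H L f g K K'
    by (simp_all add: op_cat_def Grp_def Comonads_def)
  have "is_functor (op_cat (Grp elts)) (Comonads (SetCat elts)) (Phi elts)"
  proof (rule is_functorI[OF category_op_cat[OF category_Grp] category_Comonads])
    fix G :: "'u monoid" assume "G \<in> Ob (op_cat (Grp elts))"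
    then have G: "group G" "small elts (carrier G)"
      by (auto simp: simps)
    have "lam elts (carrier G) (\<lambda>g. app elts \<psi> (restrict (\<lambda>x. x) (carrier G) g)) = \<psi>"
      if \<psi>: "\<psi> \<in> elts (fun_set elts (carrier G) X)" for X \<psi>
      by (subst (2) lam_app[OF G(2) \<psi>, symmetric]) (auto intro: lam_cong)
    then show "Fmap (Phi elts) G G (Ident (op_cat (Grp elts)) G) = Ident (Comonads (SetCat elts)) (Fob (Phi elts) G)"
      by (auto simp: simps Comonads_def SetCat_simps Phi_def K_comonad_simps Fob_K_ftor
          fun_eq_iff restrict_def)
  next
    \<comment> \<open>As group morphisms \<open>f\<close> goes from \<open>H\<close> to
      \<open>L\<close> and \<open>g\<close> from \<open>G\<close> to \<open>H\<close>, so the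
      composite in the opposite category is the map \<open>f\<close> after \<open>g\<close>.\<close>
    fix L H G :: "'u monoid" and f g
    assume "L \<in> Ob (op_cat (Grp elts))" "H \<in> Ob (op_cat (Grp elts))" "G \<in> Ob (op_cat (Grp elts))"
      and fg: "f \<in> Hom (op_cat (Grp elts)) L H" "g \<in> Hom (op_cat (Grp elts)) H G"
    then have L: "small elts (carrier L)" and H: "small elts (carrier H)" and G: "small elts (carrier G)"
      by (auto simp: simps)
    have "lam elts (carrier G) (\<lambda>x. app elts \<psi> (compose (carrier G) f g x)) =
        lam elts (carrier G) (\<lambda>x. app elts (lam elts (carrier H) (\<lambda>x. app elts \<psi> (f x))) (g x))" for \<psi>
      using fg by (auto simp: simps hom_def Pi_iff compose_def app_lam[OF H] intro!: lam_cong)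
    moreover have "lam elts (carrier H) (\<lambda>x. app elts \<psi> (f x)) \<in> elts (fun_set elts (carrier H) X)"
      if "\<psi> \<in> elts (fun_set elts (carrier L) X)" for X \<psi>
      using fg that by (auto simp: simps hom_def Pi_iff intro!: lam_in_fun_set[OF H] app_in_elts[OF L])
    ultimately show "Fmap (Phi elts) L G (Comp (op_cat (Grp elts)) L H G g f) =
        Comp (Comonads (SetCat elts)) (Fob (Phi elts) L) (Fob (Phi elts) H) (Fob (Phi elts) G)
          (Fmap (Phi elts) H G g) (Fmap (Phi elts) L H f)"
      by (auto simp: simps(4) Comonads_def vcomp_def SetCat_simps Phi_def K_comonad_simps
          Fob_K_ftor compose_def fun_eq_iff restrict_def)
  qed (auto simp: simps Phi_simps is_comonad_K_comonad comonad_hom_Phi)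
  moreover have "bij_betw (Fmap (Phi elts) H G) (Hom (op_cat (Grp elts)) H G)
      (Hom (Comonads (SetCat elts)) (Fob (Phi elts) H) (Fob (Phi elts) G))"
    if "H \<in> Ob (op_cat (Grp elts))" "G \<in> Ob (op_cat (Grp elts))" for H G :: "'u monoid"
  proof -
    have HG: "group G" "small elts (carrier G)" "group H" "small elts (carrier H)"
      using that by (auto simp: simps)
    show ?thesis
      unfolding bij_betw_def simps Phi_simps
    proof (intro conjI inj_onI equalityI subsetI)
      fix \<phi> assume "\<phi> \<in> {\<phi>. comonad_hom (SetCat elts) (K_comonad elts H) (K_comonad elts G) \<phi>}"
      then show "\<phi> \<in> Fmap (Phi elts) H G ` (hom G H \<inter> extensional (carrier G))"
        using comonad_hom_Phi_surj[OF HG] by blast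
    qed (use Phi_inj[OF HG] comonad_hom_Phi[OF HG] in auto)
  qed
  ultimately show ?thesis
    unfolding fully_faithful_def by blast
qed

lemma is_equivalence_Phi: "is_equivalence (op_cat (Grp elts)) (GrpComonads elts) (Phi elts)"
proof -
  note ff = fully_faithful_Phi
  then have F: "is_functor (op_cat (Grp elts)) (Comonads (SetCat elts)) (Phi elts)"
    unfolding fully_faithful_def by blast
  have Ob: "Ob (op_cat (Grp elts)) = Ob (Grp elts)"
    by (simp add: op_cat_def)
  have "fully_faithful (op_cat (Grp elts)) (GrpComonads elts) (Phi elts)"
    unfolding GrpComonads_def
  proof (rule fully_faithful_full_subcat[OF ff])
    fix G :: "'u monoid" assume G: "G \<in> Ob (op_cat (Grp elts))"
    then have "isomorphic (Comonads (SetCat elts)) (Fob (Phi elts) G) (Fob (Phi elts) G)"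
      by (intro isomorphic_refl category_Comonads Fob_in_Ob[OF F])
    with G show "Fob (Phi elts) G \<in> {T. \<exists>G\<in>Ob (Grp elts). isomorphic (Comonads (SetCat elts)) T (K_comonad elts G)}"
      by (auto simp: Ob Phi_simps)
  qed
  then show ?thesis
  proof (rule fully_faithful_essentially_surjective_equivalence)
    fix T assume "T \<in> Ob (GrpComonads elts)"
    then obtain G where "G \<in> Ob (Grp elts)" "isomorphic (Comonads (SetCat elts)) T (K_comonad elts G)"
      by (auto simp: GrpComonads_def full_subcat_def)
    \<comment> \<open>Passing to a full subcategory changes only \<open>Ob\<close>, which
      \<open>cat_iso\<close> does not mention.\<close>
    moreover have "isomorphic (GrpComonads elts) K K' \<longleftrightarrow> isomorphic (Comonads (SetCat elts)) K K'" for K K'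
      by (simp add: isomorphic_def cat_iso_def GrpComonads_def full_subcat_def)
    ultimately show "\<exists>G\<in>Ob (op_cat (Grp elts)). isomorphic (GrpComonads elts) (Fob (Phi elts) G) T"
      by (auto simp: Ob Phi_simps intro: isomorphic_sym)
  qed
qed

end

theorem corollary1:
  fixes elts :: "'u \<Rightarrow> 'u set"
  assumes "set_universe elts"
  shows "is_equivalence (op_cat (Grp elts)) (GrpComonads elts) (Phi elts) \<and>
         fully_faithful (op_cat (Grp elts)) (Comonads (SetCat elts)) (Phi elts)"
  using is_equivalence_Phi[OF assms] fully_faithful_Phi[OF assms] by blast

end
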